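(* Let $A,B$ be groups and let $G$ be a subgroup of $A\times B$ with Goursat quintuple $\{\overline{G}_1,G_1,\overline{G}_2,G_2,\theta\}$. (a) The subgroup $G$ is finite cyclic if and only if $\overline{G}_1,\overline{G}_2$ are both finite cyclic and $G_1,G_2$ have coprime order. Furthermore, in this case, $|G|=\mathrm{lcm}(|\overline{G}_1|,|\overline{G}_2|)$. (b) The subgroup $G$ is infinite cyclic if and only if one of the following holds: $\overline{G}_1$ is infinite cyclic, $\overline{G}_2$ is finite cyclic, and $G_2=\{0\}$; or $\overline{G}_2$ is infinite cyclic, $\overline{G}_1$ is finite cyclic, and $G_1=\{0\}$; or both $\overline{G}_1,\overline{G}_2$ are infinite cyclic and $G_1=G_2=\{0\}$.
   Context: For a subgroup $G\le A\times B$ with neutral elements written $e$, its Goursat quintuple is $\{\overline{G}_1,G_1,\overline{G}_2,G_2,\theta\}$, where $\overline{G}_1=\{a\in A\mid (a,b)\in G\text{ for some }b\in B\}$, $G_1=\{a\in A\mid (a,e)\in G\}\unlhd\overline{G}_1$, $\overline{G}_2=\{b\in B\mid (a,b)\in G\text{ for some }a\in A\}$, $G_2=\{b\in B\mid (e,b)\in G\}\unlhd\overline{G}_2$, and $\theta:\overline{G}_1/G_1\to\overline{G}_2/G_2$ is the isomorphism given by $\theta([a])=[b]$ whenever $(a,b)\in G$. Additive notation is used for cyclic groups, so $\{0\}$ denotes the trivial subgroup. The trivial group counts as finite cyclic. *)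

theory Defs
  imports "HOL-Algebra.Elementary_Groups"
begin

definition finite_cyclic_group :: "('a, 'm) monoid_scheme \<Rightarrow> bool"
  where "finite_cyclic_group K \<longleftrightarrow> cyclic_group K \<and> finite (carrier K)"

definition infinite_cyclic_group :: "('a, 'm) monoid_scheme \<Rightarrow> bool"
  where "infinite_cyclic_group K \<longleftrightarrow> cyclic_group K \<and> infinite (carrier K)"

definition goursat_proj1 ::
    "('a, 'm) monoid_scheme \<Rightarrow> ('b, 'n) monoid_scheme \<Rightarrow> ('a \<times> 'b) set \<Rightarrow> 'a set"
  where "goursat_proj1 A B G = {a \<in> carrier A. \<exists>b \<in> carrier B. (a, b) \<in> G}"

definition goursat_ker1 ::
    "('a, 'm) monoid_scheme \<Rightarrow> ('b, 'n) monoid_scheme \<Rightarrow> ('a \<times> 'b) set \<Rightarrow> 'a set"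
  where "goursat_ker1 A B G = {a \<in> carrier A. (a, \<one>\<^bsub>B\<^esub>) \<in> G}"

definition goursat_proj2 ::
    "('a, 'm) monoid_scheme \<Rightarrow> ('b, 'n) monoid_scheme \<Rightarrow> ('a \<times> 'b) set \<Rightarrow> 'b set"
  where "goursat_proj2 A B G = {b \<in> carrier B. \<exists>a \<in> carrier A. (a, b) \<in> G}"

definition goursat_ker2 ::
    "('a, 'm) monoid_scheme \<Rightarrow> ('b, 'n) monoid_scheme \<Rightarrow> ('a \<times> 'b) set \<Rightarrow> 'b set"
  where "goursat_ker2 A B G = {b \<in> carrier B. (\<one>\<^bsub>A\<^esub>, b) \<in> G}"

definition goursat_quot1 ::
    "('a, 'm) monoid_scheme \<Rightarrow> ('b, 'n) monoid_scheme \<Rightarrow> ('a \<times> 'b) set \<Rightarrow> 'a set monoid"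
  where "goursat_quot1 A B G = A\<lparr>carrier := goursat_proj1 A B G\<rparr> Mod goursat_ker1 A B G"

definition goursat_quot2 ::
    "('a, 'm) monoid_scheme \<Rightarrow> ('b, 'n) monoid_scheme \<Rightarrow> ('a \<times> 'b) set \<Rightarrow> 'b set monoid"
  where "goursat_quot2 A B G = B\<lparr>carrier := goursat_proj2 A B G\<rparr> Mod goursat_ker2 A B G"

text \<open>
  The description below determines a function when \<open>G\<close> is a subgroup of \<open>A \<times>\<times> B\<close>, and this
  function is an isomorphism; see \<open>goursat_theta_coset\<close> and \<open>goursat_theta_iso\<close>.
  Outside the quotient group it is made \<open>undefined\<close>.
\<close>

definition goursat_theta ::
    "('a, 'm) monoid_scheme \<Rightarrow> ('b, 'n) monoid_scheme \<Rightarrow> ('a \<times> 'b) set \<Rightarrow> 'a set \<Rightarrow> 'b set"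
  where "goursat_theta A B G =
    (\<lambda>X \<in> carrier (goursat_quot1 A B G).
       THE Y. \<exists>a b. (a, b) \<in> G \<and>
         X = goursat_ker1 A B G #>\<^bsub>A\<^esub> a \<and> Y = goursat_ker2 A B G #>\<^bsub>B\<^esub> b)"

definition goursat_quintuple ::
    "('a, 'm) monoid_scheme \<Rightarrow> ('b, 'n) monoid_scheme \<Rightarrow> ('a \<times> 'b) set \<Rightarrow>
       'a set \<times> 'a set \<times> 'b set \<times> 'b set \<times> ('a set \<Rightarrow> 'b set)"
  where "goursat_quintuple A B G =
    (goursat_proj1 A B G, goursat_ker1 A B G, goursat_proj2 A B G, goursat_ker2 A B G,
     goursat_theta A B G)"

locale goursat = A: group A + B: group B
  for A (structure) and B (structure) +
  fixes G
  assumes sub: "subgroup G (A \<times>\<times> B)"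
begin

lemma mem: "(a, b) \<in> G \<Longrightarrow> a \<in> carrier A \<and> b \<in> carrier B"
  using subgroup.mem_carrier[OF sub] by fastforce

lemma mult_mem: "(a, b) \<in> G \<Longrightarrow> (c, d) \<in> G \<Longrightarrow> (a \<otimes>\<^bsub>A\<^esub> c, b \<otimes>\<^bsub>B\<^esub> d) \<in> G"
  using subgroup.m_closed[OF sub] by fastforce

lemma inv_mem: "(a, b) \<in> G \<Longrightarrow> (inv\<^bsub>A\<^esub> a, inv\<^bsub>B\<^esub> b) \<in> G"
  using subgroup.m_inv_closed[OF sub, of "(a, b)"] mem[of a b]
  by (simp add: inv_DirProd A.is_group B.is_group)

lemma one_mem: "(\<one>\<^bsub>A\<^esub>, \<one>\<^bsub>B\<^esub>) \<in> G"
  using subgroup.one_closed[OF sub] by simp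

lemma subgroup_proj1: "subgroup (goursat_proj1 A B G) A"
proof (rule A.subgroupI)
  show "goursat_proj1 A B G \<noteq> {}"
    using one_mem by (auto simp: goursat_proj1_def)
next
  fix a assume "a \<in> goursat_proj1 A B G"
  then show "inv\<^bsub>A\<^esub> a \<in> goursat_proj1 A B G"
    using inv_mem mem unfolding goursat_proj1_def by blast
next
  fix a c assume "a \<in> goursat_proj1 A B G" "c \<in> goursat_proj1 A B G"
  then show "a \<otimes>\<^bsub>A\<^esub> c \<in> goursat_proj1 A B G"
    using mult_mem mem unfolding goursat_proj1_def by blast
qed (auto simp: goursat_proj1_def)

lemma subgroup_proj2: "subgroup (goursat_proj2 A B G) B"
proof (rule B.subgroupI)
  show "goursat_proj2 A B G \<noteq> {}"
    using one_mem by (auto simp: goursat_proj2_def)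
next
  fix a assume "a \<in> goursat_proj2 A B G"
  then show "inv\<^bsub>B\<^esub> a \<in> goursat_proj2 A B G"
    using inv_mem mem unfolding goursat_proj2_def by blast
next
  fix a c assume "a \<in> goursat_proj2 A B G" "c \<in> goursat_proj2 A B G"
  then show "a \<otimes>\<^bsub>B\<^esub> c \<in> goursat_proj2 A B G"
    using mult_mem mem unfolding goursat_proj2_def by blast
qed (auto simp: goursat_proj2_def)

lemma subgroup_ker1: "subgroup (goursat_ker1 A B G) A"
proof (rule A.subgroupI)
  show "goursat_ker1 A B G \<noteq> {}"
    using one_mem by (auto simp: goursat_ker1_def)
next
  fix a assume "a \<in> goursat_ker1 A B G"
  then show "inv\<^bsub>A\<^esub> a \<in> goursat_ker1 A B G"
    using inv_mem[of a "\<one>\<^bsub>B\<^esub>"] by (simp add: goursat_ker1_def)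
next
  fix a c assume "a \<in> goursat_ker1 A B G" "c \<in> goursat_ker1 A B G"
  then show "a \<otimes>\<^bsub>A\<^esub> c \<in> goursat_ker1 A B G"
    using mult_mem[of a "\<one>\<^bsub>B\<^esub>" c "\<one>\<^bsub>B\<^esub>"] by (simp add: goursat_ker1_def)
qed (auto simp: goursat_ker1_def)

lemma subgroup_ker2: "subgroup (goursat_ker2 A B G) B"
proof (rule B.subgroupI)
  show "goursat_ker2 A B G \<noteq> {}"
    using one_mem by (auto simp: goursat_ker2_def)
next
  fix a assume "a \<in> goursat_ker2 A B G"
  then show "inv\<^bsub>B\<^esub> a \<in> goursat_ker2 A B G"
    using inv_mem[of "\<one>\<^bsub>A\<^esub>" a] by (simp add: goursat_ker2_def)
next
  fix a c assume "a \<in> goursat_ker2 A B G" "c \<in> goursat_ker2 A B G"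
  then show "a \<otimes>\<^bsub>B\<^esub> c \<in> goursat_ker2 A B G"
    using mult_mem[of "\<one>\<^bsub>A\<^esub>" a "\<one>\<^bsub>A\<^esub>" c] by (simp add: goursat_ker2_def)
qed (auto simp: goursat_ker2_def)

lemma normal_ker1: "goursat_ker1 A B G \<lhd> A\<lparr>carrier := goursat_proj1 A B G\<rparr>"
proof -
  let ?P = "A\<lparr>carrier := goursat_proj1 A B G\<rparr>"
  interpret P: group ?P
    by (rule A.subgroup_imp_group[OF subgroup_proj1])
  have "goursat_ker1 A B G \<subseteq> goursat_proj1 A B G"
    using mem by (auto simp: goursat_ker1_def goursat_proj1_def)
  then have "subgroup (goursat_ker1 A B G) ?P"
    by (rule A.subgroup_incl[OF subgroup_ker1 subgroup_proj1])
  moreover have "x \<otimes>\<^bsub>A\<^esub> h \<otimes>\<^bsub>A\<^esub> inv\<^bsub>A\<^esub> x \<in> goursat_ker1 A B G"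
    if x: "x \<in> goursat_proj1 A B G" and h: "h \<in> goursat_ker1 A B G" for x h
  proof -
    obtain y where y: "(x, y) \<in> G" using x by (auto simp: goursat_proj1_def)
    have "(h, \<one>\<^bsub>B\<^esub>) \<in> G" using h by (simp add: goursat_ker1_def)
    from mult_mem[OF mult_mem[OF y this] inv_mem[OF y]]
    show ?thesis using mem[OF y] h by (auto simp: goursat_ker1_def)
  qed
  ultimately show ?thesis
    unfolding P.normal_inv_iff
    by (simp add: A.m_inv_consistent[OF subgroup_proj1])
qed

lemma normal_ker2: "goursat_ker2 A B G \<lhd> B\<lparr>carrier := goursat_proj2 A B G\<rparr>"
proof -
  let ?P = "B\<lparr>carrier := goursat_proj2 A B G\<rparr>"
  interpret P: group ?P
    by (rule B.subgroup_imp_group[OF subgroup_proj2])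
  have "goursat_ker2 A B G \<subseteq> goursat_proj2 A B G"
    using mem by (auto simp: goursat_ker2_def goursat_proj2_def)
  then have "subgroup (goursat_ker2 A B G) ?P"
    by (rule B.subgroup_incl[OF subgroup_ker2 subgroup_proj2])
  moreover have "x \<otimes>\<^bsub>B\<^esub> h \<otimes>\<^bsub>B\<^esub> inv\<^bsub>B\<^esub> x \<in> goursat_ker2 A B G"
    if x: "x \<in> goursat_proj2 A B G" and h: "h \<in> goursat_ker2 A B G" for x h
  proof -
    obtain y where y: "(y, x) \<in> G" using x by (auto simp: goursat_proj2_def)
    have "(\<one>\<^bsub>A\<^esub>, h) \<in> G" using h by (simp add: goursat_ker2_def)
    from mult_mem[OF mult_mem[OF y this] inv_mem[OF y]]
    show ?thesis using mem[OF y] h by (auto simp: goursat_ker2_def)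
  qed
  ultimately show ?thesis
    unfolding P.normal_inv_iff
    by (simp add: B.m_inv_consistent[OF subgroup_proj2])
qed

lemma coset1_eq_iff:
  assumes "a \<in> carrier A" "c \<in> carrier A"
  shows "goursat_ker1 A B G #>\<^bsub>A\<^esub> a = goursat_ker1 A B G #>\<^bsub>A\<^esub> c \<longleftrightarrow>
           a \<otimes>\<^bsub>A\<^esub> inv\<^bsub>A\<^esub> c \<in> goursat_ker1 A B G"
  using assms A.subgroup_self subgroup_ker1
  by (meson A.coset_join1 A.coset_mult_inv1 A.coset_mult_inv2 A.inv_closed A.m_closed
      A.rcos_self A.repr_independence subgroup.rcos_module subgroup.subset A.is_group)

lemma coset2_eq_iff:
  assumes "a \<in> carrier B" "c \<in> carrier B"
  shows "goursat_ker2 A B G #>\<^bsub>B\<^esub> a = goursat_ker2 A B G #>\<^bsub>B\<^esub> c \<longleftrightarrow>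
           a \<otimes>\<^bsub>B\<^esub> inv\<^bsub>B\<^esub> c \<in> goursat_ker2 A B G"
  using assms B.subgroup_self subgroup_ker2
  by (meson B.coset_join1 B.coset_mult_inv1 B.coset_mult_inv2 B.inv_closed B.m_closed
      B.rcos_self B.repr_independence subgroup.rcos_module subgroup.subset B.is_group)

lemma cosets_eq_iff:
  assumes "(a, b) \<in> G" "(c, d) \<in> G"
  shows "goursat_ker1 A B G #>\<^bsub>A\<^esub> a = goursat_ker1 A B G #>\<^bsub>A\<^esub> c \<longleftrightarrow>
         goursat_ker2 A B G #>\<^bsub>B\<^esub> b = goursat_ker2 A B G #>\<^bsub>B\<^esub> d"
proof -
  let ?p = "a \<otimes>\<^bsub>A\<^esub> inv\<^bsub>A\<^esub> c" and ?q = "b \<otimes>\<^bsub>B\<^esub> inv\<^bsub>B\<^esub> d"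
  have pq: "(?p, ?q) \<in> G" using assms by (intro mult_mem inv_mem)
  have "(?p, \<one>\<^bsub>B\<^esub>) \<in> G \<longleftrightarrow> (\<one>\<^bsub>A\<^esub>, ?q) \<in> G"
  proof
    assume "(?p, \<one>\<^bsub>B\<^esub>) \<in> G"
    from mult_mem[OF inv_mem[OF this] pq] show "(\<one>\<^bsub>A\<^esub>, ?q) \<in> G"
      using mem[OF pq] by (simp add: A.l_inv)
  next
    assume "(\<one>\<^bsub>A\<^esub>, ?q) \<in> G"
    from mult_mem[OF inv_mem[OF this] pq] show "(?p, \<one>\<^bsub>B\<^esub>) \<in> G"
      using mem[OF pq] by (simp add: B.l_inv)
  qed
  then show ?thesis
    using mem[OF pq] mem[OF assms(1)] mem[OF assms(2)]
    by (simp add: coset1_eq_iff coset2_eq_iff) (simp add: goursat_ker1_def goursat_ker2_def)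
qed

lemma carrier_quot1:
  "carrier (goursat_quot1 A B G) = {goursat_ker1 A B G #>\<^bsub>A\<^esub> a | a b. (a, b) \<in> G}"
  using mem by (fastforce simp: goursat_quot1_def FactGroup_def RCOSETS_def r_coset_def
      goursat_proj1_def)

lemma carrier_quot2:
  "carrier (goursat_quot2 A B G) = {goursat_ker2 A B G #>\<^bsub>B\<^esub> b | a b. (a, b) \<in> G}"
  using mem by (fastforce simp: goursat_quot2_def FactGroup_def RCOSETS_def r_coset_def
      goursat_proj2_def)

lemma goursat_theta_coset:
  assumes "(a, b) \<in> G"
  shows "goursat_theta A B G (goursat_ker1 A B G #>\<^bsub>A\<^esub> a) = goursat_ker2 A B G #>\<^bsub>B\<^esub> b"
proof -
  have X: "goursat_ker1 A B G #>\<^bsub>A\<^esub> a \<in> carrier (goursat_quot1 A B G)"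
    using assms carrier_quot1 by blast
  show ?thesis
    unfolding goursat_theta_def restrict_apply'[OF X]
    by (rule the_equality) (use assms cosets_eq_iff in blast)+
qed

lemma mult_quot1:
  assumes "(a, b) \<in> G" "(c, d) \<in> G"
  shows "(goursat_ker1 A B G #>\<^bsub>A\<^esub> a) \<otimes>\<^bsub>goursat_quot1 A B G\<^esub> (goursat_ker1 A B G #>\<^bsub>A\<^esub> c)
    = goursat_ker1 A B G #>\<^bsub>A\<^esub> (a \<otimes>\<^bsub>A\<^esub> c)"
  using normal.rcos_sum[OF normal_ker1, of a c] assms mem[OF assms(1)] mem[OF assms(2)]
  by (auto simp: goursat_quot1_def FactGroup_def r_coset_def set_mult_def goursat_proj1_def)

lemma mult_quot2:
  assumes "(a, b) \<in> G" "(c, d) \<in> G"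
  shows "(goursat_ker2 A B G #>\<^bsub>B\<^esub> b) \<otimes>\<^bsub>goursat_quot2 A B G\<^esub> (goursat_ker2 A B G #>\<^bsub>B\<^esub> d)
    = goursat_ker2 A B G #>\<^bsub>B\<^esub> (b \<otimes>\<^bsub>B\<^esub> d)"
  using normal.rcos_sum[OF normal_ker2, of b d] assms mem[OF assms(1)] mem[OF assms(2)]
  by (auto simp: goursat_quot2_def FactGroup_def r_coset_def set_mult_def goursat_proj2_def)

lemma goursat_theta_iso:
  "goursat_theta A B G \<in> iso (goursat_quot1 A B G) (goursat_quot2 A B G)"
proof (rule isoI)
  show "goursat_theta A B G \<in> hom (goursat_quot1 A B G) (goursat_quot2 A B G)"
  proof (rule homI)
    fix X assume "X \<in> carrier (goursat_quot1 A B G)"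
    then show "goursat_theta A B G X \<in> carrier (goursat_quot2 A B G)"
      unfolding carrier_quot1 carrier_quot2 using goursat_theta_coset by blast
  next
    fix X Y
    assume "X \<in> carrier (goursat_quot1 A B G)" "Y \<in> carrier (goursat_quot1 A B G)"
    then obtain a b c d where
      ab: "(a, b) \<in> G" "X = goursat_ker1 A B G #>\<^bsub>A\<^esub> a" and
      cd: "(c, d) \<in> G" "Y = goursat_ker1 A B G #>\<^bsub>A\<^esub> c"
      unfolding carrier_quot1 by blast
    show "goursat_theta A B G (X \<otimes>\<^bsub>goursat_quot1 A B G\<^esub> Y) =
        goursat_theta A B G X \<otimes>\<^bsub>goursat_quot2 A B G\<^esub> goursat_theta A B G Y"
      using goursat_theta_coset[OF mult_mem[OF ab(1) cd(1)]]
      by (simp only: ab(2) cd(2) mult_quot1[OF ab(1) cd(1)] mult_quot2[OF ab(1) cd(1)]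
          goursat_theta_coset[OF ab(1)] goursat_theta_coset[OF cd(1)])
  qed
  have "inj_on (goursat_theta A B G) (carrier (goursat_quot1 A B G))"
  proof (rule inj_onI)
    fix X Y
    assume "X \<in> carrier (goursat_quot1 A B G)" "Y \<in> carrier (goursat_quot1 A B G)"
      and eq: "goursat_theta A B G X = goursat_theta A B G Y"
    then obtain a b c d where
      ab: "(a, b) \<in> G" "X = goursat_ker1 A B G #>\<^bsub>A\<^esub> a" and
      cd: "(c, d) \<in> G" "Y = goursat_ker1 A B G #>\<^bsub>A\<^esub> c"
      unfolding carrier_quot1 by blast
    then show "X = Y"
      using eq goursat_theta_coset cosets_eq_iff by metis
  qed
  moreover have "goursat_theta A B G ` carrier (goursat_quot1 A B G) = carrier (goursat_quot2 A B G)"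
  proof (intro equalityI subsetI)
    fix Y assume "Y \<in> goursat_theta A B G ` carrier (goursat_quot1 A B G)"
    then show "Y \<in> carrier (goursat_quot2 A B G)"
      unfolding carrier_quot1 carrier_quot2 using goursat_theta_coset by blast
  next
    fix Y assume "Y \<in> carrier (goursat_quot2 A B G)"
    then obtain a b where ab: "(a, b) \<in> G" "Y = goursat_ker2 A B G #>\<^bsub>B\<^esub> b"
      unfolding carrier_quot2 by blast
    then have "Y = goursat_theta A B G (goursat_ker1 A B G #>\<^bsub>A\<^esub> a)"
      using goursat_theta_coset by simp
    moreover have "goursat_ker1 A B G #>\<^bsub>A\<^esub> a \<in> carrier (goursat_quot1 A B G)"
      unfolding carrier_quot1 using ab(1) by blast
    ultimately show "Y \<in> goursat_theta A B G ` carrier (goursat_quot1 A B G)"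
      by blast
  qed
  ultimately show "bij_betw (goursat_theta A B G) (carrier (goursat_quot1 A B G))
      (carrier (goursat_quot2 A B G))"
    by (simp add: bij_betw_def)
qed

end

end

theory Submission
  imports Defs "HOL-Algebra.Multiplicative_Group"
begin

text \<open>
  The two projections of \<open>G\<close> are epimorphisms onto \<open>Gbar1\<close> and \<open>Gbar2\<close> whose kernels are
  isomorphic to \<open>G2\<close> and \<open>G1\<close> and intersect trivially, and nothing else about \<open>G\<close> matters.
  For finite \<open>G\<close> this gives \<open>|G| = |Gbar1| |G2| = |Gbar2| |G1|\<close>, so that \<open>|G1|\<close> and \<open>|G2|\<close> are
  coprime iff \<open>|G| = lcm |Gbar1| |Gbar2|\<close>. This least common multiple annihilates \<open>G\<close>, and if
  both projections are cyclic, then \<open>G\<close> is abelian and has an element of that order.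
  For infinite cyclic \<open>G\<close>, an epimorphism with a nontrivial kernel has a finite image.
\<close>

section \<open>Arithmetic of least common multiples\<close>

text \<open>A common divisor \<open>d\<close> of \<open>k\<close> and \<open>l\<close> leaves
  \<open>N / d\<close> a common multiple of \<open>m\<close> and \<open>n\<close>. Conversely
  \<open>N\<close> divides both \<open>lcm m n * k\<close> and \<open>lcm m n * l\<close>, hence
  their gcd, which is \<open>lcm m n\<close> for coprime \<open>k\<close> and
  \<open>l\<close>.\<close>

lemma eq_lcm_iff_coprime:
  fixes N m n k l :: nat
  assumes "N > 0" and mk: "N = m * k" and nl: "N = n * l"
  shows "N = lcm m n \<longleftrightarrow> coprime k l"
proof
  assume N: "N = lcm m n"
  show "coprime k l"
  proof (rule coprimeI)
    fix d assume "d dvd k" "d dvd l"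
    then obtain k' l' where kl: "k = d * k'" "l = d * l'" by (elim dvdE)
    have eq: "d * (n * l') = d * (m * k')" using mk nl kl by (simp add: ac_simps)
    have "d \<noteq> 0" using kl mk \<open>N > 0\<close> by auto
    with eq have "n * l' = m * k'" by simp
    then have "lcm m n dvd m * k'" by (metis dvd_triv_left lcm_least)
    then have "d * (m * k') dvd m * k'" using N mk kl by (simp add: ac_simps)
    moreover have "m * k' \<noteq> 0" using mk kl \<open>N > 0\<close> by auto
    ultimately show "is_unit d" by (simp add: dvd_mult_cancel2)
  qed
next
  assume co: "coprime k l"
  have "N dvd lcm m n * k" unfolding mk by (intro mult_dvd_mono) simp_all
  moreover have "N dvd lcm m n * l" unfolding nl by (intro mult_dvd_mono) simp_all
  ultimately have "N dvd gcd (lcm m n * k) (lcm m n * l)"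
    by (rule gcd_greatest)
  also have "\<dots> = lcm m n"
    using co by (simp flip: gcd_mult_distrib_nat)
  finally show "N = lcm m n"
    by (metis dvd_antisym dvd_triv_left lcm_least mk nl)
qed

text \<open>Splitting off \<open>gcd t l\<close> repeatedly collects in \<open>a\<close> the part of
  \<open>t\<close> whose primes divide \<open>l\<close>; divisibility of a power of \<open>l\<close>
  expresses this without prime factorizations.\<close>

lemma coprime_part_decomposition:
  fixes t l :: nat
  assumes "t > 0"
  shows "\<exists>a b e. t = a * b \<and> coprime b l \<and> a dvd l ^ e"
  using assms
proof (induction t rule: less_induct)
  case (less t)
  show ?case
  proof (cases "coprime t l")
    case True
    then show ?thesis by (metis mult_1 one_dvd)
  next
    case False
    define d where "d = gcd t l"
    have d: "d dvd t" "d dvd l" "d \<noteq> 1"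
      using False by (auto simp: d_def coprime_iff_gcd_eq_1)
    then obtain s where s: "t = d * s" by (elim dvdE)
    have "d > 1" "s > 0" using d less.prems s by (auto intro: Suc_lessI)
    then have "s < t" using s by simp
    with less.IH \<open>s > 0\<close> obtain a b e where "s = a * b" "coprime b l" "a dvd l ^ e"
      by blast
    \<comment> \<open>The factor \<open>d\<close> divides \<open>l\<close>, so it costs one more
      power of \<open>l\<close>.\<close>
    then have "t = (d * a) * b \<and> coprime b l \<and> d * a dvd l ^ Suc e"
      using s d by (simp add: mult_dvd_mono)
    then show ?thesis by blast
  qed
qed

text \<open>With \<open>t = gcd m n\<close>, \<open>m = l * t\<close> and \<open>n = k * t\<close>,
  the lcm is \<open>l * k * t\<close>. The part \<open>a\<close> of \<open>t\<close> sharing its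
  primes with \<open>l\<close> is given to \<open>m'\<close>, the remaining part \<open>b\<close> to
  \<open>n'\<close>.\<close>

lemma lcm_coprime_decomposition:
  fixes m n :: nat
  assumes "m > 0" "n > 0"
  shows "\<exists>m' n'. m' dvd m \<and> n' dvd n \<and> coprime m' n' \<and> m' * n' = lcm m n"
proof -
  define t where "t = gcd m n"
  have "t > 0" using assms by (simp add: t_def)
  obtain l k where l: "m = l * t" and k: "n = k * t" and lk: "coprime l k"
    using gcd_coprime_exists[of m n] assms unfolding t_def by auto
  obtain a b e where t: "t = a * b" and b: "coprime b l" and a: "a dvd l ^ e"
    using coprime_part_decomposition[OF \<open>t > 0\<close>] by blast
  have "coprime (l ^ e) k" "coprime (l ^ e) b"
    using lk b by (simp_all add: coprime_commute)
  then have "coprime a k" "coprime a b"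
    using a by (meson coprime_divisors dvd_refl)+
  then have "coprime (l * a) (k * b)"
    using lk b by (simp add: coprime_commute)
  moreover have "(l * a) * (k * b) = lcm m n"
  proof -
    have "t * ((l * a) * (k * b)) = m * n"
      by (simp add: l k t ac_simps)
    also have "\<dots> = t * lcm m n"
      unfolding t_def by (rule prod_gcd_lcm_nat)
    finally have "t * ((l * a) * (k * b)) = t * lcm m n" .
    then show ?thesis using \<open>t > 0\<close> by simp
  qed
  ultimately show ?thesis
    using l k t by (intro exI[of _ "l * a"] exI[of _ "k * b"]) (simp add: mult_dvd_mono)
qed

section \<open>Orders of elements and finite cyclic groups\<close>

lemma (in comm_group) ord_mult_coprime:
  assumes x: "x \<in> carrier G" and y: "y \<in> carrier G" and co: "coprime (ord x) (ord y)"
  shows "ord (x \<otimes> y) = ord x * ord y"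
proof (rule dvd_antisym)
  let ?k = "ord (x \<otimes> y)"
  \<comment> \<open>Raising \<open>u \<otimes> v\<close> to a multiple of \<open>ord v\<close>
    isolates a power of \<open>u\<close>; coprimality then removes the extra factor
    \<open>ord v\<close>.\<close>
  have aux: "ord u dvd ord (u \<otimes> v)"
    if "u \<in> carrier G" "v \<in> carrier G" "coprime (ord u) (ord v)" for u v
  proof -
    let ?k = "ord (u \<otimes> v)"
    have "u [^] (?k * ord v) = u [^] (?k * ord v) \<otimes> v [^] (?k * ord v)"
      using that by (simp add: pow_eq_id)
    also have "\<dots> = (u \<otimes> v) [^] (?k * ord v)"
      using that by (simp add: nat_pow_distrib)
    also have "\<dots> = \<one>"
      using that by (simp add: pow_eq_id)
    finally have "ord u dvd ?k * ord v"
      using that by (simp add: pow_eq_id)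
    then show ?thesis
      using that by (simp add: coprime_dvd_mult_left_iff)
  qed
  have "ord x dvd ?k" "ord y dvd ?k"
    using aux[OF x y co] aux[OF y x] co x y by (simp_all add: coprime_commute m_comm)
  then show "ord x * ord y dvd ?k"
    using co by (rule divides_mult)
  show "?k dvd ord x * ord y"
    using x y by (rule abelian_ord_mul_divides)
qed

text \<open>Suitable powers of \<open>x\<close> and \<open>y\<close> have coprime orders
  \<open>m'\<close> and \<open>n'\<close> with product \<open>lcm m n\<close>, and coprime orders
  multiply.\<close>

lemma (in comm_group) exists_ord_eq_lcm:
  assumes x: "x \<in> carrier G" "ord x > 0" "m dvd ord x"
    and y: "y \<in> carrier G" "ord y > 0" "n dvd ord y"
  shows "\<exists>z\<in>carrier G. ord z = lcm m n"
proof -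
  have pos: "m > 0" "n > 0" using x y by (auto intro: Nat.gr0I)
  obtain m' n' where mn: "m' dvd m" "n' dvd n" "coprime m' n'" "m' * n' = lcm m n"
    using lcm_coprime_decomposition[OF pos] by blast
  have ord_div: "ord (u [^] (ord u div d)) = d"
    if "u \<in> carrier G" "ord u > 0" "d dvd ord u" for u d
  proof -
    have "ord u div d dvd ord u" "ord u div d \<noteq> 0"
      using that by (auto simp: dvd_div_eq_0_iff)
    then show ?thesis
      using that by (simp add: ord_pow div_div_eq_right)
  qed
  let ?u = "x [^] (ord x div m')" and ?v = "y [^] (ord y div n')"
  have "ord ?u = m'" "ord ?v = n'"
    using mn x y by (auto intro!: ord_div intro: dvd_trans)
  then have "ord (?u \<otimes> ?v) = lcm m n"
    using mn x(1) y(1) by (simp add: ord_mult_coprime)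
  then show ?thesis
    using x(1) y(1) by blast
qed

lemma (in group) finite_cyclic_iff_ord:
  assumes "finite (carrier G)"
  shows "cyclic_group G \<longleftrightarrow> (\<exists>x\<in>carrier G. ord x = order G)"
proof
  assume "cyclic_group G"
  then show "\<exists>x\<in>carrier G. ord x = order G"
    unfolding cyclic_group_def by (metis cyclic_order_is_ord)
next
  assume "\<exists>x\<in>carrier G. ord x = order G"
  then obtain x where x: "x \<in> carrier G" "ord x = order G" by blast
  have sub: "range (\<lambda>n::int. x [^] n) \<subseteq> carrier G"
    using x by auto
  have "card (range (\<lambda>n::int. x [^] n)) = card (carrier G)"
    using cyclic_order_is_ord[OF x(1)] carrier_subgroup_generated_by_singleton[OF x(1)] x(2)
    by (simp add: order_def)
  then have "carrier G = range (\<lambda>n::int. x [^] n)"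
    using card_subset_eq[OF assms sub] by simp
  then show "cyclic_group G"
    unfolding cyclic_group using x(1) by blast
qed

section \<open>Epimorphisms, their kernels and cyclicity\<close>

lemma (in group_hom) order_epi:
  assumes "h ` carrier G = carrier H"
  shows "order G = order H * card (kernel G H h)"
proof -
  have "card (carrier (G Mod kernel G H h)) = card (carrier H)"
    using FactGroup_iso_set[OF assms] by (auto simp: iso_def bij_betw_same_card)
  then show ?thesis
    using G.lagrange[OF subgroup_kernel] by (simp add: order_def FactGroup_def)
qed

lemma (in group_hom) ord_hom_dvd:
  "x \<in> carrier G \<Longrightarrow> H.ord (h x) dvd G.ord x"
  by (metis G.pow_ord_eq_1 H.pow_eq_id hom_closed hom_nat_pow hom_one)

lemma (in group_hom) cyclic_epi:
  assumes "h ` carrier G = carrier H" "cyclic_group G"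
  shows "cyclic_group H"
  using G.cyclic_group_epimorphic_image[of h H] assms homh by (simp add: epi_def)

lemma (in group_hom) trivial_kernel_iso:
  assumes "h ` carrier G = carrier H" "kernel G H h = {\<one>}"
  shows "h \<in> iso G H"
  using assms inj_iff_trivial_ker homh by (simp add: iso_def bij_betw_def)

lemma (in group_hom) infinite_cyclic_iff_if_trivial_kernel:
  assumes "h ` carrier G = carrier H" "kernel G H h = {\<one>}"
  shows "infinite_cyclic_group G \<longleftrightarrow> infinite_cyclic_group H"
proof -
  note iso = trivial_kernel_iso[OF assms]
  then have "cyclic_group G \<longleftrightarrow> cyclic_group H"
    using isomorphic_group_cyclicity[of G H] by (auto simp: is_iso_def)
  moreover have "finite (carrier G) \<longleftrightarrow> finite (carrier H)"
    using iso by (auto simp: iso_def bij_betw_finite)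
  ultimately show ?thesis
    by (simp add: infinite_cyclic_group_def)
qed

text \<open>The image of a generator generates the infinite group \<open>H\<close>, so only its
  zeroth power is trivial.\<close>

lemma (in group_hom) infinite_cyclic_kernel:
  assumes onto: "h ` carrier G = carrier H" and "cyclic_group G" and inf: "infinite (carrier H)"
  shows "kernel G H h = {\<one>}"
proof -
  obtain x where x: "x \<in> carrier G" "carrier G = range (\<lambda>n::int. x [^] n)"
    using \<open>cyclic_group G\<close> unfolding G.cyclic_group by blast
  have "carrier H = range (\<lambda>n::int. h x [^]\<^bsub>H\<^esub> n)"
    unfolding onto[symmetric] using x by (auto simp: image_image hom_int_pow)
  then have "infinite (carrier (subgroup_generated H {h x}))"
    using inf H.carrier_subgroup_generated_by_singleton[OF hom_closed[OF x(1)]] by simp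
  \<comment> \<open>The value 0 of \<open>ord\<close> stands for infinite order, so an exponent that
    kills \<open>h x\<close> must be a multiple of 0.\<close>
  then have "H.ord (h x) = 0"
    using x(1) by (simp add: H.infinite_cyclic_subgroup_order)
  then have "n = 0" if "h (x [^] n) = \<one>\<^bsub>H\<^esub>" for n :: int
    using that x(1) by (simp add: hom_int_pow H.int_pow_eq_id)
  then have "kernel G H h \<subseteq> {\<one>}"
    unfolding kernel_def x(2) by fastforce
  then show ?thesis
    by (auto simp: kernel_def)
qed

section \<open>Groups with two jointly injective epimorphisms\<close>

text \<open>Up to isomorphism, \<open>H\<close> is a subdirect product of \<open>K\<close> and
  \<open>L\<close>. Stating this abstractly keeps pairs out of the argument and makes the roles of
  \<open>p\<close> and \<open>q\<close> symmetric.\<close>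

locale jointly_injective_epis = p: group_hom H K p + q: group_hom H L q
  for H (structure) and K (structure) and L (structure) and p q +
  assumes p_onto: "p ` carrier H = carrier K"
    and q_onto: "q ` carrier H = carrier L"
    and joint_kernel: "\<And>x. x \<in> carrier H \<Longrightarrow> p x = \<one>\<^bsub>K\<^esub> \<Longrightarrow> q x = \<one>\<^bsub>L\<^esub> \<Longrightarrow> x = \<one>\<^bsub>H\<^esub>"
begin

lemma jointly_inj:
  assumes "x \<in> carrier H" "y \<in> carrier H" "p x = p y" "q x = q y"
  shows "x = y"
proof -
  have "x \<otimes>\<^bsub>H\<^esub> inv\<^bsub>H\<^esub> y = \<one>\<^bsub>H\<^esub>"
    using assms by (intro joint_kernel) simp_all
  then show ?thesis
    using assms by (metis p.G.inv_closed p.G.inv_equality p.G.inv_inv)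
qed

lemma finite_carrier_iff:
  "finite (carrier H) \<longleftrightarrow> finite (carrier K) \<and> finite (carrier L)"
proof
  assume "finite (carrier H)"
  then show "finite (carrier K) \<and> finite (carrier L)"
    by (metis p_onto q_onto finite_imageI)
next
  assume fin: "finite (carrier K) \<and> finite (carrier L)"
  have "inj_on (\<lambda>x. (p x, q x)) (carrier H)"
    by (rule inj_onI) (auto intro: jointly_inj)
  moreover have "(\<lambda>x. (p x, q x)) ` carrier H \<subseteq> carrier K \<times> carrier L"
    by auto
  ultimately show "finite (carrier H)"
    using fin by (meson finite_SigmaI finite_imageD finite_subset)
qed

text \<open>The exponent kills both images of \<open>x\<close> by Lagrange. If \<open>K\<close> or
  \<open>L\<close> is infinite, its order is 0 and so is the exponent.\<close>

lemma pow_lcm_order: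
  assumes "x \<in> carrier H"
  shows "x [^]\<^bsub>H\<^esub> lcm (order K) (order L) = \<one>\<^bsub>H\<^esub>"
proof (rule joint_kernel)
  show "p (x [^]\<^bsub>H\<^esub> lcm (order K) (order L)) = \<one>\<^bsub>K\<^esub>"
    using assms p.H.ord_dvd_group_order[of "p x"]
    by (auto simp: p.hom_nat_pow p.H.pow_eq_id intro: dvd_trans)
  show "q (x [^]\<^bsub>H\<^esub> lcm (order K) (order L)) = \<one>\<^bsub>L\<^esub>"
    using assms q.H.ord_dvd_group_order[of "q x"]
    by (auto simp: q.hom_nat_pow q.H.pow_eq_id intro: dvd_trans)
qed (use assms in simp)

text \<open>Each epimorphism factors \<open>order H\<close> as the order of its image times that of
  its kernel, so the kernel orders are the cofactors in the lcm criterion.\<close>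

lemma coprime_kernels_iff:
  assumes "finite (carrier H)"
  shows "coprime (card (kernel H K p)) (card (kernel H L q)) \<longleftrightarrow>
    order H = lcm (order K) (order L)"
  using eq_lcm_iff_coprime[OF _ p.order_epi[OF p_onto] q.order_epi[OF q_onto]] assms
  by (simp add: p.G.order_gt_0_iff_finite)

lemma comm_group_if_images_comm:
  assumes "comm_group K" "comm_group L"
  shows "comm_group H"
proof (rule p.G.group_comm_groupI)
  interpret K: comm_group K by fact
  interpret L: comm_group L by fact
  fix x y assume "x \<in> carrier H" "y \<in> carrier H"
  then show "x \<otimes>\<^bsub>H\<^esub> y = y \<otimes>\<^bsub>H\<^esub> x"
    by (intro jointly_inj) (simp_all add: K.m_comm L.m_comm)
qed

text \<open>A generator has order \<open>order H\<close> and is killed by the lcm, while both image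
  orders divide \<open>order H\<close>.\<close>

lemma finite_cyclic_group_order:
  assumes "finite_cyclic_group H"
  shows "order H = lcm (order K) (order L)"
proof (rule dvd_antisym)
  have fin: "finite (carrier H)" and cyc: "cyclic_group H"
    using assms by (simp_all add: finite_cyclic_group_def)
  obtain x where "x \<in> carrier H" "p.G.ord x = order H"
    using cyc p.G.finite_cyclic_iff_ord[OF fin] by blast
  then show "order H dvd lcm (order K) (order L)"
    using pow_lcm_order by (metis p.G.pow_eq_id)
  show "lcm (order K) (order L) dvd order H"
    using p.order_epi[OF p_onto] q.order_epi[OF q_onto] by (metis dvd_triv_left lcm_least)
qed

lemma finite_cyclic_group_iff:
  "finite_cyclic_group H \<longleftrightarrow> finite_cyclic_group K \<and> finite_cyclic_group L \<and>
    coprime (card (kernel H K p)) (card (kernel H L q))"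
proof
  assume H: "finite_cyclic_group H"
  then have fin: "finite (carrier H)" and cyc: "cyclic_group H"
    by (simp_all add: finite_cyclic_group_def)
  then show "finite_cyclic_group K \<and> finite_cyclic_group L \<and>
    coprime (card (kernel H K p)) (card (kernel H L q))"
    using finite_carrier_iff p.cyclic_epi[OF p_onto cyc] q.cyclic_epi[OF q_onto cyc]
      finite_cyclic_group_order[OF H]
    by (simp add: finite_cyclic_group_def coprime_kernels_iff)
next
  assume R: "finite_cyclic_group K \<and> finite_cyclic_group L \<and>
    coprime (card (kernel H K p)) (card (kernel H L q))"
  then have K: "finite (carrier K)" "cyclic_group K" and L: "finite (carrier L)" "cyclic_group L"
    by (simp_all add: finite_cyclic_group_def)
  have fin: "finite (carrier H)"
    using K L finite_carrier_iff by blast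
  interpret H: comm_group H
    using K L comm_group_if_images_comm p.H.cyclic_imp_abelian_group q.H.cyclic_imp_abelian_group
    by blast
  \<comment> \<open>Lifts \<open>x\<close> and \<open>y\<close> of generators of \<open>K\<close>
    and \<open>L\<close> have orders divisible by \<open>order K\<close> and
    \<open>order L\<close>.\<close>
  obtain x where x: "x \<in> carrier H" "p.H.ord (p x) = order K"
    using K p.H.finite_cyclic_iff_ord p_onto by (metis imageE)
  obtain y where y: "y \<in> carrier H" "q.H.ord (q y) = order L"
    using L q.H.finite_cyclic_iff_ord q_onto by (metis imageE)
  have "\<exists>z\<in>carrier H. p.G.ord z = lcm (order K) (order L)"
  proof (rule H.exists_ord_eq_lcm)
    show "p.G.ord x > 0" "p.G.ord y > 0"
      using p.G.ord_ge_1[OF fin] x(1) y(1) by (simp_all add: Suc_le_eq)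
    show "order K dvd p.G.ord x" "order L dvd p.G.ord y"
      using p.ord_hom_dvd[OF x(1)] q.ord_hom_dvd[OF y(1)] x(2) y(2) by simp_all
  qed (use x y in simp_all)
  \<comment> \<open>Coprime kernel orders make the lcm equal to \<open>order H\<close>, so the
    element of that order generates \<open>H\<close>.\<close>
  then show "finite_cyclic_group H"
    using R fin coprime_kernels_iff[OF fin] p.G.finite_cyclic_iff_ord[OF fin]
    by (simp add: finite_cyclic_group_def)
qed

text \<open>If \<open>H\<close> is infinite, so is one of its images, and an infinite image of a
  cyclic group forces a trivial kernel. Conversely, each case contains an isomorphism of
  \<open>H\<close> onto an infinite cyclic image.\<close>

lemma infinite_cyclic_group_iff:
  "infinite_cyclic_group H \<longleftrightarrow>
    (infinite_cyclic_group K \<and> finite_cyclic_group L \<and> kernel H K p = {\<one>\<^bsub>H\<^esub>}) \<or>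
    (infinite_cyclic_group L \<and> finite_cyclic_group K \<and> kernel H L q = {\<one>\<^bsub>H\<^esub>}) \<or>
    (infinite_cyclic_group K \<and> infinite_cyclic_group L \<and>
      kernel H L q = {\<one>\<^bsub>H\<^esub>} \<and> kernel H K p = {\<one>\<^bsub>H\<^esub>})"
  (is "_ \<longleftrightarrow> ?R")
proof
  assume "infinite_cyclic_group H"
  then have inf: "infinite (carrier H)" and cyc: "cyclic_group H"
    by (simp_all add: infinite_cyclic_group_def)
  then show ?R
    using finite_carrier_iff p.cyclic_epi[OF p_onto cyc] q.cyclic_epi[OF q_onto cyc]
      p.infinite_cyclic_kernel[OF p_onto cyc] q.infinite_cyclic_kernel[OF q_onto cyc]
    unfolding infinite_cyclic_group_def finite_cyclic_group_def by blast
next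
  assume ?R
  then show "infinite_cyclic_group H"
    using p.infinite_cyclic_iff_if_trivial_kernel[OF p_onto]
      q.infinite_cyclic_iff_if_trivial_kernel[OF q_onto] by blast
qed

end

section \<open>Application to Goursat subgroups\<close>

context goursat
begin

abbreviation subproduct :: "('a \<times> 'c) monoid"
  where "subproduct \<equiv> (A \<times>\<times> B)\<lparr>carrier := G\<rparr>"

lemma projections:
  "jointly_injective_epis subproduct (A\<lparr>carrier := goursat_proj1 A B G\<rparr>)
    (B\<lparr>carrier := goursat_proj2 A B G\<rparr>) fst snd"
proof -
  have "group subproduct"
    using group.subgroup_imp_group[OF DirProd_group[OF A.is_group B.is_group] sub] .
  moreover have "fst ` G = goursat_proj1 A B G" "snd ` G = goursat_proj2 A B G"
    using mem by (force simp: goursat_proj1_def goursat_proj2_def)+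
  ultimately show ?thesis
    using A.subgroup_imp_group[OF subgroup_proj1] B.subgroup_imp_group[OF subgroup_proj2]
    by (auto simp: jointly_injective_epis_def jointly_injective_epis_axioms_def
        group_hom_def group_hom_axioms_def hom_def DirProd_def)
qed

text \<open>The indices cross over: projecting to the first factor loses \<open>G2\<close>. The
  carrier \<open>X\<close> is arbitrary because a kernel sees only the unit of the target.\<close>

lemma kernel_fst:
  "kernel subproduct (A\<lparr>carrier := X\<rparr>) fst = {\<one>\<^bsub>A\<^esub>} \<times> goursat_ker2 A B G"
  using mem by (auto simp: kernel_def goursat_ker2_def)

lemma kernel_snd:
  "kernel subproduct (B\<lparr>carrier := X\<rparr>) snd = goursat_ker1 A B G \<times> {\<one>\<^bsub>B\<^esub>}"
  using mem by (auto simp: kernel_def goursat_ker1_def)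

end

theorem theorem4p4:
  fixes A :: "('a, 'm) monoid_scheme" and B :: "('b, 'n) monoid_scheme"
    and G :: "('a \<times> 'b) set"
    and Gbar1 G1 :: "'a set" and Gbar2 G2 :: "'b set" and \<theta> :: "'a set \<Rightarrow> 'b set"
  assumes "group A" and "group B" and "subgroup G (A \<times>\<times> B)"
    and "goursat_quintuple A B G = (Gbar1, G1, Gbar2, G2, \<theta>)"
  shows "((finite_cyclic_group ((A \<times>\<times> B)\<lparr>carrier := G\<rparr>) \<longleftrightarrow>
            finite_cyclic_group (A\<lparr>carrier := Gbar1\<rparr>) \<and>
            finite_cyclic_group (B\<lparr>carrier := Gbar2\<rparr>) \<and>
            coprime (card G1) (card G2)) \<and>
          (finite_cyclic_group ((A \<times>\<times> B)\<lparr>carrier := G\<rparr>) \<longrightarrow>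
            card G = lcm (card Gbar1) (card Gbar2)))
       \<and> (infinite_cyclic_group ((A \<times>\<times> B)\<lparr>carrier := G\<rparr>) \<longleftrightarrow>
            (infinite_cyclic_group (A\<lparr>carrier := Gbar1\<rparr>) \<and>
             finite_cyclic_group (B\<lparr>carrier := Gbar2\<rparr>) \<and> G2 = {\<one>\<^bsub>B\<^esub>}) \<or>
            (infinite_cyclic_group (B\<lparr>carrier := Gbar2\<rparr>) \<and>
             finite_cyclic_group (A\<lparr>carrier := Gbar1\<rparr>) \<and> G1 = {\<one>\<^bsub>A\<^esub>}) \<or>
            (infinite_cyclic_group (A\<lparr>carrier := Gbar1\<rparr>) \<and>
             infinite_cyclic_group (B\<lparr>carrier := Gbar2\<rparr>) \<and>
             G1 = {\<one>\<^bsub>A\<^esub>} \<and> G2 = {\<one>\<^bsub>B\<^esub>}))"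
proof -
  interpret goursat A B G
    using assms(1-3) by (simp add: goursat_def goursat_axioms_def)
  have eqs: "Gbar1 = goursat_proj1 A B G" "G1 = goursat_ker1 A B G"
    "Gbar2 = goursat_proj2 A B G" "G2 = goursat_ker2 A B G"
    using assms(4) by (simp_all add: goursat_quintuple_def)
  interpret jointly_injective_epis "(A \<times>\<times> B)\<lparr>carrier := G\<rparr>"
    "A\<lparr>carrier := Gbar1\<rparr>" "B\<lparr>carrier := Gbar2\<rparr>" fst snd
    unfolding eqs by (rule projections)
  have card: "card ({\<one>\<^bsub>A\<^esub>} \<times> G2) = card G2" "card (G1 \<times> {\<one>\<^bsub>B\<^esub>}) = card G1"
    by (simp_all add: card_cartesian_product)
  have trivial: "{\<one>\<^bsub>A\<^esub>} \<times> G2 = {(\<one>\<^bsub>A\<^esub>, \<one>\<^bsub>B\<^esub>)} \<longleftrightarrow> G2 = {\<one>\<^bsub>B\<^esub>}"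
    "G1 \<times> {\<one>\<^bsub>B\<^esub>} = {(\<one>\<^bsub>A\<^esub>, \<one>\<^bsub>B\<^esub>)} \<longleftrightarrow> G1 = {\<one>\<^bsub>A\<^esub>}"
    by auto
  note kernels = kernel_fst[folded eqs] kernel_snd[folded eqs]
  \<comment> \<open>The crossed kernels give coprimality with \<open>G2\<close> before
    \<open>G1\<close>, whence \<open>coprime_commute\<close>.\<close>
  show ?thesis
    using finite_cyclic_group_iff finite_cyclic_group_order infinite_cyclic_group_iff
    by (simp add: kernels card trivial order_def coprime_commute)
qed

end
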